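(* Let $k\ge 2$ be an integer. A square matrix $A$ with all entries in $\{0,1\}$ satisfies $A^k=A$ if and only if either $A=0$ or $A$ is permutation similar to a block matrix $$\begin{pmatrix} 0 & X & XP^TY\\ 0 & P & Y\\ 0 & 0 & 0\end{pmatrix},$$ where the two diagonal zero blocks are square zero matrices (each of which may be vacuous, i.e. of order $0$), $P=C_{n_1}\oplus C_{n_2}\oplus\cdots\oplus C_{n_r}$ with $n_i\mid k-1$ for $i=1,\ldots,r$, and $X$ and $Y$ are matrices with entries in $\{0,1\}$ such that $XP^TY$ also has all entries in $\{0,1\}$.
   Context: $C_m$ denotes the $m\times m$ basic circulant matrix, i.e. the adjacency matrix of the directed cycle on $m$ vertices: $C_m(i,i+1)=1$ for $1\le i\le m-1$, $C_m(m,1)=1$, all other entries $0$ (so $C_1=(1)$). $\oplus$ denotes the direct sum (block diagonal matrix). Two square matrices are permutation similar if $B=Q^TAQ$ for some permutation matrix $Q$. *)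

theory Defs
  imports "Jordan_Normal_Form.Matrix"
begin

text \<open>Indices start at 0 in this matrix library, so the entries 1 of \<open>C\<^sub>m\<close> are at
  \<open>(i, i + 1)\<close> for \<open>i < m - 1\<close> and at \<open>(m - 1, 0)\<close>.\<close>

definition circulant_mat :: "nat \<Rightarrow> 'a::{zero,one} mat" where
  "circulant_mat m = mat m m (\<lambda>(i, j). if j = (i + 1) mod m then 1 else 0)"

definition zero_one_mat :: "'a::{zero,one} mat \<Rightarrow> bool" where
  "zero_one_mat A \<longleftrightarrow> elements_mat A \<subseteq> {0, 1}"

definition permutation_mat :: "nat \<Rightarrow> 'a::{zero,one} mat \<Rightarrow> bool" where
  "permutation_mat n Q \<longleftrightarrow>
     Q \<in> carrier_mat n n \<and> zero_one_mat Q \<and>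
     (\<forall>i<n. \<exists>!j. j < n \<and> Q $$ (i, j) = 1) \<and>
     (\<forall>j<n. \<exists>!i. i < n \<and> Q $$ (i, j) = 1)"

definition permutation_similar :: "'a::semiring_1 mat \<Rightarrow> 'a mat \<Rightarrow> bool" where
  "permutation_similar A B \<longleftrightarrow>
     (\<exists>n Q. A \<in> carrier_mat n n \<and> B \<in> carrier_mat n n \<and> permutation_mat n Q \<and>
        B = transpose_mat Q * A * Q)"

text \<open>The 3-by-3 block matrix with rows \<open>(0, X, X P\<^sup>T Y)\<close>, \<open>(0, P, Y)\<close>, \<open>(0, 0, 0)\<close>,
  assembled as a 2-by-2 block matrix whose upper left block consists of the first two block rows
  and columns. The first and last diagonal blocks have orders \<open>dim_row X\<close> and \<open>dim_col Y\<close>.\<close>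

definition cyclic_block_form :: "'a::semiring_1 mat \<Rightarrow> 'a mat \<Rightarrow> 'a mat \<Rightarrow> 'a mat" where
  "cyclic_block_form X P Y =
     (let p = dim_row X; s = dim_row P; q = dim_col Y in
      four_block_mat
        (four_block_mat (0\<^sub>m p p) X (0\<^sub>m s p) P) ((X * transpose_mat P * Y) @\<^sub>r Y)
        (0\<^sub>m q (p + s)) (0\<^sub>m q q))"

end

theory Submission
  imports Defs
begin

text \<open>
  For a matrix in block form, \<open>P\<^bsup>k-1\<^esup> = I\<close>, and the block form factors as \<open>U P V\<close> with \<open>V U = I\<close>, so
  its \<open>k\<close>-th power is \<open>U P\<^bsup>k\<^esup> V = U P V\<close>.

  Conversely, view \<open>A\<close> as a matrix over the natural numbers. If \<open>A\<^bsup>k\<^esup> = A\<close>, then \<open>E = A\<^bsup>k-1\<^esup>\<close> is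
  idempotent and \<open>A E = E A = A\<close>. Let \<open>S\<close> be the set of indices with a nonzero diagonal entry of
  \<open>E\<close>. Nonnegativity forces \<open>E\<close> to be the identity on \<open>S \<times> S\<close>, and for \<open>l \<notin> S\<close> either row \<open>l\<close> or
  column \<open>l\<close> of \<open>E\<close>, hence of \<open>A\<close>, vanishes. So \<open>A\<close> restricted to \<open>S\<close> is invertible over the natural
  numbers, that is, a permutation matrix, of order dividing \<open>k - 1\<close>, and \<open>A = A E\<close> expresses
  the remaining entries of \<open>A\<close> as \<open>X P\<^sup>T Y\<close>. Listing the zero columns, then \<open>S\<close> cycle by cycle,
  then the zero rows gives the block form.
\<close>

subsection \<open>Idempotent and potent matrices over the natural numbers\<close>

lemma index_mult_mat_sum:
  assumes "A \<in> carrier_mat n m" "B \<in> carrier_mat m r" "i < n" "j < r"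
  shows "(A * B) $$ (i, j) = (\<Sum>l<m. A $$ (i, l) * B $$ (l, j))"
  using assms by (auto simp: scalar_prod_def lessThan_atLeast0 intro!: sum.cong)

lemma pow_mat_add:
  fixes A :: "'a::semiring_1 mat"
  assumes A: "A \<in> carrier_mat n n"
  shows "A ^\<^sub>m (a + b) = A ^\<^sub>m a * A ^\<^sub>m b"
proof (induction b)
  case 0
  then show ?case using pow_carrier_mat[OF A, of a] A by simp
next
  case (Suc b)
  then show ?case
    using assoc_mult_mat[OF pow_carrier_mat[OF A, of a] pow_carrier_mat[OF A, of b] A] by simp
qed

text \<open>Natural numbers do not cancel, so one summand of a product entry is a lower bound for
  the whole entry. The positivity arguments below rest on this.\<close>

lemma mult_entries_le_index_mult:
  fixes A B :: "nat mat"
  assumes "A \<in> carrier_mat n m" "B \<in> carrier_mat m r" "i < n" "j < r" "l < m"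
  shows "A $$ (i, l) * B $$ (l, j) \<le> (A * B) $$ (i, j)"
  using assms member_le_sum[of l "{..<m}" "\<lambda>l. A $$ (i, l) * B $$ (l, j)"]
  by (simp add: index_mult_mat_sum[OF assms(1-4)])

lemma index_mult_pos_obtains:
  fixes A B :: "nat mat"
  assumes "A \<in> carrier_mat n m" "B \<in> carrier_mat m r" "i < n" "j < r" "(A * B) $$ (i, j) > 0"
  obtains l where "l < m" "A $$ (i, l) > 0" "B $$ (l, j) > 0"
proof -
  have "(\<Sum>l<m. A $$ (i, l) * B $$ (l, j)) \<noteq> 0"
    using assms(5) unfolding index_mult_mat_sum[OF assms(1-4)] by linarith
  then obtain l where "l < m" "A $$ (i, l) * B $$ (l, j) \<noteq> 0"
    by (meson lessThan_iff sum.not_neutral_contains_not_neutral)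
  then show ?thesis using that by simp
qed

section \<open>Idempotent matrices over the natural numbers\<close>

context
  fixes E :: "nat mat" and n :: nat
  assumes E: "E \<in> carrier_mat n n" and idem: "E * E = E"
begin

lemma idempotent_nat_trans:
  assumes "i < n" "l < n" "j < n" "E $$ (i, l) > 0" "E $$ (l, j) > 0"
  shows "E $$ (i, j) > 0"
proof -
  have "E $$ (i, l) * E $$ (l, j) \<le> E $$ (i, j)"
    using mult_entries_le_index_mult[OF E E, of i j l] assms idem by simp
  moreover have "E $$ (i, l) * E $$ (l, j) > 0" using assms by simp
  ultimately show ?thesis by linarith
qed

text \<open>The square of a diagonal entry is a summand of the same entry of
  \<open>E * E = E\<close>, and a positive natural number with square at most itself is 1.\<close>

lemma idempotent_nat_diag:
  assumes "s < n" "E $$ (s, s) > 0"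
  shows "E $$ (s, s) = 1"
  using mult_entries_le_index_mult[OF E E, of s s s] assms idem by simp

text \<open>In the sum for \<open>(E * E) $$ (s, j)\<close> the summand at \<open>s\<close> is
  already \<open>1 * E $$ (s, j)\<close>, the full value, so every other summand vanishes.\<close>

lemma idempotent_nat_through_diag:
  assumes "s < n" "E $$ (s, s) > 0" "l < n" "l \<noteq> s" "j < n"
  shows "E $$ (s, l) * E $$ (l, j) = 0"
proof -
  have "(\<Sum>x\<in>{s, l}. E $$ (s, x) * E $$ (x, j)) \<le> (\<Sum>x<n. E $$ (s, x) * E $$ (x, j))"
    using assms by (intro sum_mono2) auto
  also have "\<dots> = E $$ (s, j)"
    using index_mult_mat_sum[OF E E, of s j] assms idem by simp
  finally show ?thesis using assms idempotent_nat_diag[of s] by simp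
qed

lemma idempotent_nat_diag_block:
  assumes "s < n" "E $$ (s, s) > 0" "t < n" "E $$ (t, t) > 0"
  shows "E $$ (s, t) = (if s = t then 1 else 0)"
  using idempotent_nat_through_diag[of s t t] idempotent_nat_diag assms by auto

text \<open>The relation \<open>E $$ (i, j) > 0\<close> is transitive and dense, so in a finite interval it must
  pass through a reflexive point.\<close>

lemma idempotent_nat_diag_between:
  assumes "i < n" "l < n" "E $$ (i, l) > 0"
  shows "\<exists>s<n. E $$ (s, s) > 0 \<and> E $$ (i, s) > 0 \<and> E $$ (s, l) > 0"
  using assms
proof (induction "card {y. y < n \<and> E $$ (i, y) > 0 \<and> E $$ (y, l) > 0}" arbitrary: l
    rule: less_induct)
  case less
  let ?I = "\<lambda>l. {y. y < n \<and> E $$ (i, y) > 0 \<and> E $$ (y, l) > 0}"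
  obtain y where y: "y < n" "E $$ (i, y) > 0" "E $$ (y, l) > 0"
    by (rule index_mult_pos_obtains[OF E E less.prems(1,2)]) (use less.prems idem in auto)
  show ?case
  proof (cases "E $$ (y, y) > 0")
    case True
    then show ?thesis using y by blast
  next
    case False
    \<comment> \<open>Moving the endpoint from \<open>l\<close> to \<open>y\<close> shrinks the
      interval strictly: transitivity gives the inclusion, and \<open>y\<close> drops out because it
      is not reflexive.\<close>
    have "?I y \<subseteq> ?I l"
      using idempotent_nat_trans[OF _ y(1) less.prems(2) _ y(3)] by blast
    moreover have "y \<in> ?I l" "y \<notin> ?I y" using y False by auto
    ultimately have "?I y \<subset> ?I l" by blast
    then have "card (?I y) < card (?I l)" by (intro psubset_card_mono) simp_all
    then obtain s where "s < n" "E $$ (s, s) > 0" "E $$ (i, s) > 0" "E $$ (s, y) > 0"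
      using less.hyps[of y] y less.prems by blast
    then show ?thesis using idempotent_nat_trans[of s y l] y less.prems by auto
  qed
qed

text \<open>A positive entry in column \<open>l\<close> yields a reflexive point \<open>s\<close>
  with \<open>E $$ (s, l) > 0\<close>. A positive entry in row \<open>l\<close> would then give a
  second positive summand in row \<open>s\<close>.\<close>

lemma idempotent_nat_off_diag:
  assumes "l < n" "E $$ (l, l) = 0"
  shows "(\<forall>i<n. E $$ (i, l) = 0) \<or> (\<forall>j<n. E $$ (l, j) = 0)"
proof (rule ccontr)
  assume "\<not> ?thesis"
  then obtain i j where ij: "i < n" "j < n" "E $$ (i, l) > 0" "E $$ (l, j) > 0" by auto
  then obtain s where "s < n" "E $$ (s, s) > 0" "E $$ (s, l) > 0"
    using idempotent_nat_diag_between assms by blast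
  then show False
    using idempotent_nat_through_diag[of s l j] assms ij by (cases "l = s") auto
qed

end

text \<open>\<open>A\<close> and \<open>B\<close> multiply to \<open>E\<close> in both orders, and
  \<open>E\<close> is the identity on \<open>S\<close>, so on \<open>S\<close> they behave as
  inverse nonnegative matrices; this makes \<open>A\<close> the matrix of a permutation
  \<open>f\<close>. The sum formula is \<open>A = A * E\<close>, reindexed along
  \<open>f\<close>.\<close>

lemma potent_nat_mat_structure:
  fixes A :: "nat mat"
  assumes A: "A \<in> carrier_mat n n" and k: "k \<ge> 2" and Ak: "A ^\<^sub>m k = A"
  obtains S f where
    "S \<subseteq> {..<n}" "f ` S \<subseteq> S" "\<And>s. s \<in> S \<Longrightarrow> (f ^^ (k - 1)) s = s"
    "\<And>s t. s \<in> S \<Longrightarrow> t \<in> S \<Longrightarrow> A $$ (s, t) = (if t = f s then 1 else 0)"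
    "\<And>i j. i < n \<Longrightarrow> j < n \<Longrightarrow> A $$ (i, j) = (\<Sum>t\<in>S. A $$ (i, f t) * A $$ (t, j))"
    "\<And>l. l < n \<Longrightarrow> l \<notin> S \<Longrightarrow> (\<forall>i<n. A $$ (i, l) = 0) \<or> (\<forall>j<n. A $$ (l, j) = 0)"
proof -
  define E where "E = A ^\<^sub>m (k - 1)"
  \<comment> \<open>For \<open>k = 2\<close> this is the identity matrix, and then
    \<open>E = A\<close>.\<close>
  define B where "B = A ^\<^sub>m (k - 2)"
  define S where "S = {s. s < n \<and> E $$ (s, s) > 0}"
  have E: "E \<in> carrier_mat n n" and B: "B \<in> carrier_mat n n"
    using A by (simp_all add: E_def B_def)
  have A1: "A ^\<^sub>m 1 = A" using A by simp
  have AE: "A * E = A"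
    using pow_mat_add[OF A, of 1 "k - 1"] A1 Ak k by (simp add: E_def)
  have EA: "E * A = A"
    using pow_mat_add[OF A, of "k - 1" 1] A1 Ak k by (simp add: E_def)
  have k2: "1 + (k - 2) = k - 1" "k - 2 + 1 = k - 1" using k by simp_all
  have AB: "A * B = E"
    using pow_mat_add[OF A, of 1 "k - 2"] A1 unfolding k2 E_def B_def by simp
  have BA: "B * A = E"
    using pow_mat_add[OF A, of "k - 2" 1] A1 unfolding k2 E_def B_def by simp
  have EE: "E * E = E"
    using assoc_mult_mat[OF B A E] BA AE by simp
  have delta: "E $$ (s, t) = (if s = t then 1 else 0)" if "s \<in> S" "t \<in> S" for s t
    using idempotent_nat_diag_block[OF E EE, of s t] that by (simp add: S_def)
  have off: "(\<forall>i<n. E $$ (i, l) = 0) \<or> (\<forall>j<n. E $$ (l, j) = 0)" if "l < n" "l \<notin> S" for l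
    using idempotent_nat_off_diag[OF E EE, of l] that by (auto simp: S_def)
  \<comment> \<open>Zero columns of \<open>E\<close> pass to \<open>A\<close> through
    \<open>A = A * E\<close>, zero rows through \<open>A = E * A\<close>.\<close>
  have col0: "A $$ (i, l) = 0" if "i < n" "l < n" "\<forall>i<n. E $$ (i, l) = 0" for i l
    using index_mult_mat_sum[OF A E, of i l] that AE by simp
  have row0: "A $$ (l, j) = 0" if "j < n" "l < n" "\<forall>j<n. E $$ (l, j) = 0" for j l
    using index_mult_mat_sum[OF E A, of l j] that EA by simp
  \<comment> \<open>The diagonal entry of \<open>A * B = E\<close> at \<open>s\<close> supplies
    \<open>l\<close>; the same two factors in the reverse product \<open>B * A = E\<close> make the
    diagonal entry at \<open>l\<close> positive, so \<open>l\<close> lies in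
    \<open>S\<close>.\<close>
  have "\<exists>l\<in>S. A $$ (s, l) > 0 \<and> B $$ (l, s) > 0" if s: "s \<in> S" for s
  proof -
    have "s < n" using s by (simp add: S_def)
    have "(A * B) $$ (s, s) > 0" using s AB by (simp add: S_def)
    then obtain l where l: "l < n" "A $$ (s, l) > 0" "B $$ (l, s) > 0"
      by (rule index_mult_pos_obtains[OF A B \<open>s < n\<close> \<open>s < n\<close>])
    have "B $$ (l, s) * A $$ (s, l) \<le> E $$ (l, l)"
      using mult_entries_le_index_mult[OF B A, of l l s] \<open>s < n\<close> BA l by simp
    moreover have "B $$ (l, s) * A $$ (s, l) > 0" using l by simp
    ultimately have "E $$ (l, l) > 0" by linarith
    then show ?thesis using l by (auto simp: S_def)
  qed
  then obtain f where f: "\<And>s. s \<in> S \<Longrightarrow> f s \<in> S"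
      and fA: "\<And>s. s \<in> S \<Longrightarrow> A $$ (s, f s) > 0" and fB: "\<And>s. s \<in> S \<Longrightarrow> B $$ (f s, s) > 0"
    by metis
  have Sn: "s < n" if "s \<in> S" for s using that by (simp add: S_def)
  have AS: "A $$ (s, t) = (if t = f s then 1 else 0)" if "s \<in> S" "t \<in> S" for s t
  proof -
    \<comment> \<open>Row \<open>f s\<close> of \<open>E\<close> is a unit vector on
      \<open>S\<close>, which bounds row \<open>s\<close> of \<open>A\<close> there.\<close>
    have "B $$ (f s, s) * A $$ (s, t) \<le> E $$ (f s, t)"
      using mult_entries_le_index_mult[OF B A, of "f s" t s] BA that f Sn by simp
    moreover have "E $$ (f s, t) = (if f s = t then 1 else 0)" using delta f that by simp
    moreover have "A $$ (s, t) \<le> B $$ (f s, s) * A $$ (s, t)" using fB[of s] that by simp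
    ultimately have "A $$ (s, t) \<le> (if f s = t then 1 else 0)" by linarith
    then show ?thesis using fA[of s] that by (cases "t = f s") auto
  qed
  have inj: "inj_on f S"
  proof (rule inj_onI)
    fix s t assume st: "s \<in> S" "t \<in> S" "f s = f t"
    have "A $$ (t, f s) * B $$ (f s, s) \<le> E $$ (t, s)"
      using mult_entries_le_index_mult[OF A B, of t s "f s"] AB st f Sn by simp
    moreover have "A $$ (t, f s) * B $$ (f s, s) > 0" using fA[of t] fB[of s] st by simp
    ultimately have "E $$ (t, s) > 0" by linarith
    then show "s = t" using delta[of t s] st by (auto split: if_splits)
  qed
  have finS: "finite S" by (simp add: S_def)
  have img: "f ` S = S" using endo_inj_surj[OF finS _ inj] f by blast
  \<comment> \<open>Following \<open>f\<close> for \<open>m\<close> steps is a walk that makes an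
    entry of the \<open>m\<close>-th power positive. For \<open>m = k - 1\<close> this is an entry
    of \<open>E\<close>, so the walk must end where it began.\<close>
  have iter: "(f ^^ m) s \<in> S \<and> (A ^\<^sub>m m) $$ (s, (f ^^ m) s) > 0" if s: "s \<in> S" for m s
  proof (induction m)
    case 0
    then show ?case using s Sn A by simp
  next
    case (Suc m)
    let ?t = "(f ^^ m) s"
    have "(A ^\<^sub>m m) $$ (s, ?t) * A $$ (?t, f ?t) \<le> (A ^\<^sub>m m * A) $$ (s, f ?t)"
      using Suc s f Sn by (intro mult_entries_le_index_mult[OF pow_carrier_mat[OF A] A]) auto
    moreover have "(A ^\<^sub>m m) $$ (s, ?t) * A $$ (?t, f ?t) > 0" using Suc fA by simp
    ultimately have "(A ^\<^sub>m m * A) $$ (s, f ?t) > 0" by linarith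
    then show ?case using Suc f by (simp del: index_mult_mat)
  qed
  have period: "(f ^^ (k - 1)) s = s" if "s \<in> S" for s
    using iter[OF that, of "k - 1"] delta[OF that, of "(f ^^ (k - 1)) s"]
    by (auto simp: E_def split: if_splits)
  have AE_S: "A $$ (i, j) = (\<Sum>l\<in>S. A $$ (i, l) * E $$ (l, j))" if "i < n" "j < n" for i j
  proof -
    have "A $$ (i, j) = (\<Sum>l<n. A $$ (i, l) * E $$ (l, j))"
      using index_mult_mat_sum[OF A E] AE that by simp
    also have "\<dots> = (\<Sum>l\<in>S. A $$ (i, l) * E $$ (l, j))"
    proof (rule sum.mono_neutral_right)
      \<comment> \<open>Outside \<open>S\<close> either row \<open>l\<close> of \<open>E\<close>
        vanishes or column \<open>l\<close> of \<open>E\<close>, and with it column \<open>l\<close>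
        of \<open>A\<close>.\<close>
      show "\<forall>l\<in>{..<n} - S. A $$ (i, l) * E $$ (l, j) = 0"
      proof
        fix l assume "l \<in> {..<n} - S"
        then show "A $$ (i, l) * E $$ (l, j) = 0" using off[of l] col0[of i l] that by auto
      qed
    qed (auto simp: S_def)
    finally show ?thesis .
  qed
  \<comment> \<open>On \<open>S\<close>, row \<open>t\<close> of \<open>A\<close> is the unit vector
    at \<open>f t\<close>, so \<open>A = A * E\<close> copies row \<open>f t\<close> of
    \<open>E\<close>, also in columns outside \<open>S\<close>.\<close>
  have fE: "E $$ (f t, j) = A $$ (t, j)" if "t \<in> S" "j < n" for t j
  proof -
    have "A $$ (t, j) = (\<Sum>l\<in>S. A $$ (t, l) * E $$ (l, j))"
      using AE_S that Sn by simp
    also have "\<dots> = (\<Sum>l\<in>S. if l = f t then E $$ (l, j) else 0)"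
      using AS that by (intro sum.cong) auto
    also have "\<dots> = E $$ (f t, j)" using finS f that by simp
    finally show ?thesis by simp
  qed
  show ?thesis
  proof
    show "A $$ (i, j) = (\<Sum>t\<in>S. A $$ (i, f t) * A $$ (t, j))" if "i < n" "j < n" for i j
    proof -
      have "A $$ (i, j) = (\<Sum>l\<in>f ` S. A $$ (i, l) * E $$ (l, j))"
        using AE_S that img by simp
      also have "\<dots> = (\<Sum>t\<in>S. A $$ (i, f t) * A $$ (t, j))"
        using fE that by (simp add: sum.reindex[OF inj])
      finally show ?thesis .
    qed
    show "(\<forall>i<n. A $$ (i, l) = 0) \<or> (\<forall>j<n. A $$ (l, j) = 0)" if "l < n" "l \<notin> S" for l
      using off[OF that] col0 row0 that by blast
  qed (use AS period img Sn in auto)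
qed

subsection \<open>Cycles and circulant blocks\<close>

text \<open>The cycle is the orbit of \<open>x\<close> up to its least period \<open>d\<close>,
  which exists because \<open>m\<close> is a period.\<close>

lemma ex_cycle_through:
  assumes f: "f ` S \<subseteq> S" and m: "m > 0" and period: "\<And>x. x \<in> S \<Longrightarrow> (f ^^ m) x = x"
    and x: "x \<in> S"
  shows "\<exists>c. distinct c \<and> x \<in> set c \<and> set c \<subseteq> S \<and> length c dvd m \<and>
    (\<forall>i<length c. f (c ! i) = c ! ((i + 1) mod length c))"
proof -
  define d where "d = (LEAST d. d > 0 \<and> (f ^^ d) x = x)"
  have d: "d > 0" "(f ^^ d) x = x"
    using LeastI[of "\<lambda>d. d > 0 \<and> (f ^^ d) x = x" m] m period[OF x] by (simp_all add: d_def)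
  have least: "(f ^^ e) x \<noteq> x" if "0 < e" "e < d" for e
    using not_less_Least[of e "\<lambda>d. d > 0 \<and> (f ^^ d) x = x"] that by (auto simp: d_def)
  define c where "c = map (\<lambda>i. (f ^^ i) x) [0..<d]"
  have len: "length c = d" by (simp add: c_def)
  have nth: "c ! i = (f ^^ i) x" if "i < d" for i
    using that by (simp add: c_def)
  have "inj_on (\<lambda>i. (f ^^ i) x) {0..<d}"
    by (rule inj_on_funpow_least) (use d least in auto)
  then have "distinct c" by (simp add: c_def distinct_map)
  moreover have "x \<in> set c"
    using nth_mem[of 0 c] nth[of 0] d by (simp add: len)
  moreover have "(f ^^ i) x \<in> S" for i
    by (induction i) (use f x in auto)
  then have "set c \<subseteq> S" by (auto simp: c_def)
  \<comment> \<open>The remainder \<open>m mod d\<close> would be a smaller period unless it is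
    0.\<close>
  moreover have "(f ^^ (m mod d)) x = x"
    using funpow_mod_eq[OF d(2)] period[OF x] by metis
  then have "d dvd m"
    using least[of "m mod d"] d(1) by (cases "m mod d = 0") auto
  moreover have "f (c ! i) = c ! ((i + 1) mod d)" if "i < d" for i
    using that d nth[of i] nth[of "(i + 1) mod d"] by (cases "i + 1 = d") auto
  ultimately show ?thesis using len by blast
qed

text \<open>Cycle decomposition of a permutation: split off the orbit of one point and recurse on
  the complement.\<close>

lemma ex_cycle_list:
  assumes "finite S" "f ` S \<subseteq> S" "m > 0" "\<And>x. x \<in> S \<Longrightarrow> (f ^^ m) x = x"
  shows "\<exists>cs. distinct (concat cs) \<and> set (concat cs) = S \<and>
    (\<forall>c\<in>set cs. c \<noteq> [] \<and> length c dvd m \<and> (\<forall>i<length c. f (c ! i) = c ! ((i + 1) mod length c)))"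
  using assms
proof (induction S rule: finite_psubset_induct)
  case (psubset S)
  show ?case
  proof (cases "S = {}")
    case True
    then show ?thesis by (intro exI[of _ "[]"]) simp
  next
    case False
    then obtain x where "x \<in> S" by blast
    then obtain c where c: "distinct c" "x \<in> set c" "set c \<subseteq> S" "length c dvd m"
        "\<And>i. i < length c \<Longrightarrow> f (c ! i) = c ! ((i + 1) mod length c)"
      using ex_cycle_through[OF psubset.prems] by blast
    have fc: "f y \<in> set c" if y: "y \<in> set c" for y
    proof -
      obtain i where i: "i < length c" "c ! i = y" using y by (auto simp: in_set_conv_nth)
      then have "(i + 1) mod length c < length c" by (intro mod_less_divisor) auto
      then show ?thesis using c(5)[OF i(1)] i(2) nth_mem by metis
    qed
    have "f ` (S - set c) \<subseteq> S - set c"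
    proof
      fix z assume "z \<in> f ` (S - set c)"
      then obtain y where y: "y \<in> S" "y \<notin> set c" "z = f y" by blast
      \<comment> \<open>If \<open>z = f y\<close> lay on the cycle, so would \<open>y\<close>, which
        is reached from \<open>z\<close> by \<open>m - 1\<close> further steps. Hence the complement
        is closed under \<open>f\<close> as well.\<close>
      have stay: "(f ^^ i) z \<in> set c" if "z \<in> set c" for i
        by (induction i) (use that fc in auto)
      have "(f ^^ (m - 1)) z = y"
        using psubset.prems(2) psubset.prems(3)[OF y(1)] y(3)
        by (metis Suc_diff_1 comp_apply funpow_Suc_right)
      then have "z \<notin> set c" using stay[of "m - 1"] y(2) by auto
      then show "z \<in> S - set c" using y(1,3) psubset.prems(1) by auto
    qed
    moreover have "S - set c \<subset> S" using c(2,3) by blast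
    ultimately obtain cs where cs: "distinct (concat cs)" "set (concat cs) = S - set c"
        "\<forall>c\<in>set cs. c \<noteq> [] \<and> length c dvd m \<and>
          (\<forall>i<length c. f (c ! i) = c ! ((i + 1) mod length c))"
      using psubset.IH[of "S - set c"] psubset.prems(2,3) by auto
    show ?thesis
      by (rule exI[of _ "c # cs"]) (use c cs in auto)
  qed
qed

text \<open>Listed cycle by cycle, the matrix of \<open>f\<close> is a direct sum of circulants:
  within a cycle \<open>f\<close> advances the position by one, cyclically, and different cycles do
  not meet.\<close>

lemma diag_block_circulant_eq:
  assumes "distinct (concat cs)"
    and "\<And>c. c \<in> set cs \<Longrightarrow> c \<noteq> [] \<and> (\<forall>i<length c. f (c ! i) = c ! ((i + 1) mod length c))"
  shows "diag_block_mat (map circulant_mat (map length cs)) =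
    (mat (length (concat cs)) (length (concat cs))
      (\<lambda>(i, j). if concat cs ! j = f (concat cs ! i) then 1 else 0) :: 'a::{zero,one} mat)"
  using assms
proof (induction cs)
  case Nil
  then show ?case by auto
next
  case (Cons c cs)
  let ?xs = "concat cs" and ?f = "\<lambda>xs (i, j). if xs ! j = f (xs ! i) then 1 else 0 :: 'a"
  have IH: "diag_block_mat (map circulant_mat (map length cs)) = mat (length ?xs) (length ?xs) (?f ?xs)"
    using Cons by auto
  have closed: "f y \<in> set d" if d: "d \<in> set (c # cs)" and y: "y \<in> set d" for d y
  proof -
    obtain i where i: "i < length d" "d ! i = y" using y by (auto simp: in_set_conv_nth)
    then have "(i + 1) mod length d < length d" by (intro mod_less_divisor) auto
    then show ?thesis using Cons.prems(2)[OF d] i nth_mem by metis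
  qed
  have c: "f (c ! i) \<in> set c" if "i < length c" for i
    using closed[of c "c ! i"] that by simp
  have xs: "f (?xs ! i) \<in> set ?xs" if "i < length ?xs" for i
    using closed nth_mem[OF that] by fastforce
  have disj: "set c \<inter> set ?xs = {}" and dc: "distinct c" using Cons.prems(1) by auto
  have circ: "circulant_mat (length c) = mat (length c) (length c) (?f c)"
  proof (rule eq_matI)
    fix i j assume ij: "i < dim_row (mat (length c) (length c) (?f c))" "j < dim_col (mat (length c) (length c) (?f c))"
    then have "(i + 1) mod length c < length c" by (intro mod_less_divisor) auto
    then have "c ! j = f (c ! i) \<longleftrightarrow> j = (i + 1) mod length c"
      using ij Cons.prems(2)[of c] nth_eq_iff_index_eq[OF dc] by auto
    then show "circulant_mat (length c) $$ (i, j) = mat (length c) (length c) (?f c) $$ (i, j)"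
      using ij by (simp add: circulant_mat_def)
  qed (auto simp: circulant_mat_def)
  \<comment> \<open>These two facts make the off-diagonal blocks zero.\<close>
  have ne1: "?xs ! j \<noteq> f (c ! i)" if "i < length c" "j < length ?xs" for i j
    using disj c[OF that(1)] nth_mem[OF that(2)] by (metis disjoint_iff)
  have ne2: "c ! i \<noteq> f (?xs ! j)" if "i < length c" "j < length ?xs" for i j
    using disj xs[OF that(2)] nth_mem[OF that(1)] by (metis disjoint_iff)
  show ?case
    unfolding list.map diag_block_mat.simps Let_def IH circ
    by (rule eq_matI) (auto simp: nth_append ne1 ne2)
qed

section \<open>Powers and transposes of circulants and of their direct sums\<close>

lemma dim_circulant_mat [simp]:
  "dim_row (circulant_mat m) = m" "dim_col (circulant_mat m) = m"
  by (simp_all add: circulant_mat_def)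

text \<open>Each further factor moves the 1 of every row one column on, cyclically. The closed form
  turns the next two lemmas into arithmetic modulo \<open>m\<close>.\<close>

lemma circulant_mat_pow:
  "circulant_mat m ^\<^sub>m a = (mat m m (\<lambda>(i, j). if j = (i + a) mod m then 1 else 0) :: 'a::semiring_1 mat)"
proof (induction a)
  case 0
  then show ?case by (intro eq_matI) (auto simp: circulant_mat_def)
next
  case (Suc a)
  show ?case
  proof (rule eq_matI)
    fix i j
    assume "i < dim_row (mat m m (\<lambda>(i, j). if j = (i + Suc a) mod m then 1 else 0 :: 'a))"
      "j < dim_col (mat m m (\<lambda>(i, j). if j = (i + Suc a) mod m then 1 else 0 :: 'a))"
    then have ij: "i < m" "j < m" by auto
    have "(circulant_mat m ^\<^sub>m Suc a :: 'a mat) $$ (i, j) =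
        (\<Sum>l<m. (if l = (i + a) mod m then 1 else 0) * (if j = (l + 1) mod m then 1 else 0))"
      using ij unfolding pow_mat.simps Suc
      by (simp add: scalar_prod_def circulant_mat_def lessThan_atLeast0)
    also have "\<dots> = (\<Sum>l<m. if l = (i + a) mod m then (if j = (l + 1) mod m then 1 else 0) else 0)"
      by (intro sum.cong) auto
    also have "\<dots> = (if j = ((i + a) mod m + 1) mod m then 1 else 0)"
      using ij by (simp add: mod_less_divisor)
    also have "((i + a) mod m + 1) mod m = (i + Suc a) mod m"
      by (simp add: mod_add_left_eq mod_Suc_eq)
    finally show "(circulant_mat m ^\<^sub>m Suc a :: 'a mat) $$ (i, j) =
        mat m m (\<lambda>(i, j). if j = (i + Suc a) mod m then 1 else 0) $$ (i, j)"
      using ij by simp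
  qed (auto simp: circulant_mat_def)
qed

lemma circulant_mat_pow_eq_one:
  assumes "m dvd a"
  shows "circulant_mat m ^\<^sub>m a = (1\<^sub>m m :: 'a::semiring_1 mat)"
  unfolding circulant_mat_pow using assms by (intro eq_matI) (auto elim!: dvdE)

text \<open>A shift by \<open>a\<close> undoes a shift by one when \<open>m\<close> divides
  \<open>a + 1\<close>, and the inverse of a permutation matrix is its transpose.\<close>

lemma circulant_mat_pow_eq_transpose:
  assumes "m dvd Suc a"
  shows "circulant_mat m ^\<^sub>m a = (transpose_mat (circulant_mat m) :: 'a::semiring_1 mat)"
proof -
  obtain c where c: "Suc a = m * c" using assms by (elim dvdE)
  have "j = (i + a) mod m \<longleftrightarrow> i = (j + 1) mod m" if "i < m" "j < m" for i j
  proof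
    assume "j = (i + a) mod m"
    then have "(j + 1) mod m = (i + Suc a) mod m" by (simp add: mod_Suc_eq)
    also have "\<dots> = i" using that unfolding c by simp
    finally show "i = (j + 1) mod m" by simp
  next
    assume "i = (j + 1) mod m"
    then have "(i + a) mod m = (j + Suc a) mod m" by (simp add: mod_add_left_eq)
    also have "\<dots> = j" using that unfolding c by simp
    finally show "j = (i + a) mod m" by simp
  qed
  then show ?thesis
    unfolding circulant_mat_pow by (intro eq_matI) (auto simp: circulant_mat_def)
qed

lemma transpose_diag_block_mat:
  "transpose_mat (diag_block_mat As) = diag_block_mat (map transpose_mat As)"
proof (induction As)
  case (Cons A As)
  have "diag_block_mat (map transpose_mat As) = transpose_mat (diag_block_mat As)"
    using Cons by simp
  then show ?case
    by (simp only: list.map diag_block_mat.simps Let_def) (intro eq_matI; auto)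
qed simp

text \<open>Powers and transposes act blockwise. Applied with \<open>a = k - 2\<close>, this yields
  both that \<open>P\<close> is orthogonal and that its \<open>k\<close>-th power is
  \<open>P\<close>.\<close>

lemma diag_block_circulant:
  fixes ns :: "nat list"
  assumes "\<And>m. m \<in> set ns \<Longrightarrow> m dvd Suc a"
  defines "P \<equiv> diag_block_mat (map circulant_mat ns) :: 'a::semiring_1 mat"
  shows "P \<in> carrier_mat (sum_list ns) (sum_list ns)"
    "P ^\<^sub>m Suc a = 1\<^sub>m (sum_list ns)" "P ^\<^sub>m a = transpose_mat P"
proof -
  let ?Cs = "map circulant_mat ns :: 'a mat list"
  have dims: "map dim_row ?Cs = ns" "map dim_col ?Cs = ns"
    by (simp_all add: o_def)
  then show "P \<in> carrier_mat (sum_list ns) (sum_list ns)"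
    unfolding P_def carrier_mat_def by (simp only: mem_Collect_eq dim_diag_block_mat dims simp_thms)
  have sq: "Ball (set ?Cs) square_mat" by simp
  have one: "map (\<lambda>C. C ^\<^sub>m Suc a) ?Cs = map (\<lambda>C. 1\<^sub>m (dim_row C)) ?Cs"
    using assms(1) by (simp add: circulant_mat_pow_eq_one del: pow_mat.simps)
  show "P ^\<^sub>m Suc a = 1\<^sub>m (sum_list ns)"
    unfolding P_def diag_block_pow_mat[OF sq] one diag_block_one_mat dims ..
  have transp: "map (\<lambda>C. C ^\<^sub>m a) ?Cs = map transpose_mat ?Cs"
    using assms(1) by (simp add: circulant_mat_pow_eq_transpose)
  show "P ^\<^sub>m a = transpose_mat P"
    unfolding P_def diag_block_pow_mat[OF sq] transpose_diag_block_mat transp ..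
qed

subsection \<open>Permutation similarity\<close>

text \<open>The single 1 of row \<open>i\<close>, in column \<open>l0\<close>, reduces the product
  of rows \<open>i\<close> and \<open>j\<close> to \<open>Q $$ (j, l0)\<close>, and uniqueness in
  column \<open>l0\<close> decides its value. Columns are treated in the same way.\<close>

lemma permutation_matD:
  fixes Q :: "'a::semiring_1 mat"
  assumes "permutation_mat n Q"
  shows "Q \<in> carrier_mat n n" "Q * transpose_mat Q = 1\<^sub>m n" "transpose_mat Q * Q = 1\<^sub>m n"
proof -
  show Q: "Q \<in> carrier_mat n n" using assms by (simp add: permutation_mat_def)
  have bin: "Q $$ (i, j) = 0 \<or> Q $$ (i, j) = 1" if "i < n" "j < n" for i j
    using assms elements_matI[OF Q that refl] unfolding permutation_mat_def zero_one_mat_def by blast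
  have row: "\<exists>!j. j < n \<and> Q $$ (i, j) = 1" and col: "\<exists>!j. j < n \<and> Q $$ (j, i) = 1" if "i < n" for i
    using assms that unfolding permutation_mat_def by auto
  have sum_delta: "(\<Sum>l<n. g l * h l) = h l0"
    if "l0 < n" "\<And>l. l < n \<Longrightarrow> g l = (if l = l0 then 1 else 0)" for g h :: "nat \<Rightarrow> 'a" and l0
  proof -
    have "(\<Sum>l<n. g l * h l) = (\<Sum>l<n. if l = l0 then h l else 0)"
      using that(2) by (intro sum.cong) auto
    then show ?thesis using that(1) by simp
  qed
  show "Q * transpose_mat Q = 1\<^sub>m n"
  proof (rule eq_matI)
    fix i j assume "i < dim_row (1\<^sub>m n)" "j < dim_col (1\<^sub>m n)"
    then have ij: "i < n" "j < n" by auto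
    obtain l0 where l0: "l0 < n" "Q $$ (i, l0) = 1" "\<And>l. l < n \<Longrightarrow> Q $$ (i, l) = 1 \<Longrightarrow> l = l0"
      using row[OF ij(1)] by blast
    have "Q $$ (j, l0) = (if i = j then 1 else 0)"
      using col[OF l0(1)] bin[OF ij(2) l0(1)] l0(2) ij by auto
    moreover have "Q $$ (i, l) = (if l = l0 then 1 else 0)" if "l < n" for l
    proof -
      have "Q $$ (i, l) = 1 \<longleftrightarrow> l = l0" using l0(2) l0(3)[OF that] by blast
      then show ?thesis using bin[OF ij(1) that] by auto
    qed
    then have "(\<Sum>l<n. Q $$ (i, l) * Q $$ (j, l)) = Q $$ (j, l0)"
      by (intro sum_delta[OF l0(1)]) simp
    ultimately show "(Q * transpose_mat Q) $$ (i, j) = 1\<^sub>m n $$ (i, j)"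
      using ij Q by (simp add: scalar_prod_def lessThan_atLeast0)
  qed (use Q in auto)
  show "transpose_mat Q * Q = 1\<^sub>m n"
  proof (rule eq_matI)
    fix i j assume "i < dim_row (1\<^sub>m n)" "j < dim_col (1\<^sub>m n)"
    then have ij: "i < n" "j < n" by auto
    obtain l0 where l0: "l0 < n" "Q $$ (l0, i) = 1" "\<And>l. l < n \<Longrightarrow> Q $$ (l, i) = 1 \<Longrightarrow> l = l0"
      using col[OF ij(1)] by blast
    have "Q $$ (l0, j) = (if i = j then 1 else 0)"
      using row[OF l0(1)] bin[OF l0(1) ij(2)] l0(2) ij by auto
    moreover have "Q $$ (l, i) = (if l = l0 then 1 else 0)" if "l < n" for l
    proof -
      have "Q $$ (l, i) = 1 \<longleftrightarrow> l = l0" using l0(2) l0(3)[OF that] by blast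
      then show ?thesis using bin[OF that ij(1)] by auto
    qed
    then have "(\<Sum>l<n. Q $$ (l, i) * Q $$ (l, j)) = Q $$ (l0, j)"
      by (intro sum_delta[OF l0(1)]) simp
    ultimately show "(transpose_mat Q * Q) $$ (i, j) = 1\<^sub>m n $$ (i, j)"
      using ij Q by (simp add: scalar_prod_def lessThan_atLeast0)
  qed (use Q in auto)
qed

lemma permutation_similar_reindex:
  fixes A :: "'a::semiring_1 mat"
  assumes A: "A \<in> carrier_mat n n" and L: "distinct L" "set L = {..<n}"
  shows "permutation_similar A (mat n n (\<lambda>(i, j). A $$ (L ! i, L ! j)))"
proof -
  \<comment> \<open>Column \<open>j\<close> is the unit vector at \<open>L ! j\<close>, so
    conjugation by \<open>Q\<close> lists rows and columns in the order of \<open>L\<close>.\<close>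
  define Q :: "'a mat" where "Q = mat n n (\<lambda>(i, j). if i = L ! j then 1 else 0)"
  have len: "length L = n" using distinct_card[OF L(1)] L(2) by simp
  have Ln: "L ! i < n" if "i < n" for i using nth_mem[of i L] that L(2) len by auto
  have inj: "L ! i = L ! j \<longleftrightarrow> i = j" if "i < n" "j < n" for i j
    using nth_eq_iff_index_eq[OF L(1)] that len by simp
  have surj: "\<exists>j<n. i = L ! j" if "i < n" for i
    using that L(2) len in_set_conv_nth[of i L] by auto
  have "permutation_mat n Q"
    unfolding permutation_mat_def
  proof (intro conjI allI impI)
    show "zero_one_mat Q" by (auto simp: zero_one_mat_def Q_def dest!: elements_matD split: if_splits)
    fix i assume i: "i < n"
    then obtain j where "j < n" "i = L ! j" using surj by blast
    then show "\<exists>!j. j < n \<and> Q $$ (i, j) = 1"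
      using i inj by (intro ex1I[of _ j]) (auto simp: Q_def split: if_splits)
    show "\<exists>!j. j < n \<and> Q $$ (j, i) = 1"
      using i Ln[OF i] by (intro ex1I[of _ "L ! i"]) (auto simp: Q_def split: if_splits)
  qed (simp add: Q_def)
  moreover have "mat n n (\<lambda>(i, j). A $$ (L ! i, L ! j)) = transpose_mat Q * A * Q"
  proof (rule eq_matI)
    fix i j assume "i < dim_row (transpose_mat Q * A * Q)" "j < dim_col (transpose_mat Q * A * Q)"
    then have ij: "i < n" "j < n" by (auto simp: Q_def)
    have TA: "(transpose_mat Q * A) $$ (i, l) = A $$ (L ! i, l)" if "l < n" for l
    proof -
      have "(transpose_mat Q * A) $$ (i, l) = (\<Sum>r<n. (if r = L ! i then 1 else 0) * A $$ (r, l))"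
        using ij that A by (simp add: Q_def scalar_prod_def lessThan_atLeast0)
      also have "\<dots> = (\<Sum>r<n. if r = L ! i then A $$ (r, l) else 0)"
        by (intro sum.cong) auto
      finally show ?thesis using Ln ij by simp
    qed
    have "(transpose_mat Q * A * Q) $$ (i, j) =
        (\<Sum>l<n. (transpose_mat Q * A) $$ (i, l) * (if l = L ! j then 1 else 0))"
      using ij A by (simp add: Q_def scalar_prod_def lessThan_atLeast0)
    also have "\<dots> = (\<Sum>l<n. if l = L ! j then A $$ (L ! i, l) else 0)"
      using TA by (intro sum.cong) auto
    also have "\<dots> = A $$ (L ! i, L ! j)" using Ln ij by simp
    finally show "mat n n (\<lambda>(i, j). A $$ (L ! i, L ! j)) $$ (i, j) = (transpose_mat Q * A * Q) $$ (i, j)"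
      using ij by simp
  qed (use A in \<open>auto simp: Q_def\<close>)
  ultimately show ?thesis
    unfolding permutation_similar_def using A by (metis mat_carrier)
qed

text \<open>Since \<open>Q\<close> is orthogonal, this is ordinary similarity, and powers commute
  with conjugation.\<close>

lemma permutation_similar_potent:
  fixes A B :: "'a::semiring_1 mat"
  assumes "permutation_similar A B" "B ^\<^sub>m k = B"
  shows "A ^\<^sub>m k = A"
proof -
  obtain n Q where A: "A \<in> carrier_mat n n" and B: "B \<in> carrier_mat n n"
      and Q: "permutation_mat n Q" and BQ: "B = transpose_mat Q * A * Q"
    using assms(1) unfolding permutation_similar_def by blast
  note Q = permutation_matD[OF Q]
  have "similar_mat_wit B A (transpose_mat Q) Q"
    using A B BQ Q by (intro similar_mat_witI[of _ _ n]) auto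
  then have wit: "similar_mat_wit A B Q (transpose_mat Q)"
    by (rule similar_mat_wit_sym)
  show ?thesis
    using similar_mat_wit_pow_id[OF wit, of k] similar_mat_witD2(3)[OF A wit] assms(2) by simp
qed

subsection \<open>The block form\<close>

lemma index_cyclic_block_form:
  fixes X P Y :: "'a::semiring_1 mat"
  assumes "X \<in> carrier_mat p s" "P \<in> carrier_mat s s" "Y \<in> carrier_mat s q"
    and "i < p + s + q" "j < p + s + q"
  shows "cyclic_block_form X P Y $$ (i, j) =
    (if i < p then
       if j < p then 0 else if j < p + s then X $$ (i, j - p)
       else (X * transpose_mat P * Y) $$ (i, j - p - s)
     else if i < p + s then
       if j < p then 0 else if j < p + s then P $$ (i - p, j - p) else Y $$ (i - p, j - p - s)
     else 0)"
  using assms by (auto simp: cyclic_block_form_def Let_def append_rows_def)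

lemma cyclic_block_form_carrier:
  assumes "X \<in> carrier_mat p s" "P \<in> carrier_mat s s" "Y \<in> carrier_mat s q"
  shows "cyclic_block_form X P Y \<in> carrier_mat (p + s + q) (p + s + q)"
  using assms by (auto simp: cyclic_block_form_def Let_def)

text \<open>Between consecutive factors \<open>V * U\<close> cancels, so only the powers of
  \<open>P\<close> accumulate.\<close>

lemma pow_mat_sandwich:
  fixes U P V :: "'a::semiring_1 mat"
  assumes U: "U \<in> carrier_mat n s" and P: "P \<in> carrier_mat s s" and V: "V \<in> carrier_mat s n"
    and VU: "V * U = 1\<^sub>m s"
  shows "(U * P * V) ^\<^sub>m Suc a = U * P ^\<^sub>m Suc a * V"
proof (induction a)
  case 0
  then show ?case using assms by simp
next
  case (Suc a)
  let ?R = "P ^\<^sub>m Suc a"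
  have R: "?R \<in> carrier_mat s s" using P by (intro pow_carrier_mat)
  have UR: "U * ?R \<in> carrier_mat n s" and PV: "P * V \<in> carrier_mat s n"
    and UPV: "U * (P * V) \<in> carrier_mat n n"
    using U R P V by (blast intro: mult_carrier_mat)+
  have "(U * P * V) ^\<^sub>m Suc (Suc a) = (U * ?R * V) * (U * (P * V))"
    using Suc assoc_mult_mat[OF U P V] by simp
  also have "\<dots> = U * ?R * (V * (U * (P * V)))"
    by (rule assoc_mult_mat[OF UR V UPV])
  also have "V * (U * (P * V)) = V * U * (P * V)"
    by (rule assoc_mult_mat[OF V U PV, symmetric])
  also have "\<dots> = P * V" unfolding VU by (rule left_mult_one_mat[OF PV])
  also have "U * ?R * (P * V) = U * ?R * P * V"
    by (rule assoc_mult_mat[OF UR P V, symmetric])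
  also have "U * ?R * P = U * (?R * P)"
    by (rule assoc_mult_mat[OF U R P])
  finally show ?case by simp
qed

text \<open>With \<open>U = (X P\<^sup>T, I, 0)\<^sup>T\<close> and \<open>V = (0, I, P\<^sup>T Y)\<close>, the block form is \<open>U P V\<close> and \<open>V U = I\<close>.\<close>

lemma cyclic_block_form_pow:
  fixes X P Y :: "'a::semiring_1 mat"
  assumes X: "X \<in> carrier_mat p s" and P: "P \<in> carrier_mat s s" and Y: "Y \<in> carrier_mat s q"
    and PPT: "P * transpose_mat P = 1\<^sub>m s" and PTP: "transpose_mat P * P = 1\<^sub>m s"
    and Pa: "P ^\<^sub>m Suc a = P"
  shows "cyclic_block_form X P Y ^\<^sub>m Suc a = cyclic_block_form X P Y"
proof -
  let ?n = "p + s + q"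
  let ?T = "transpose_mat P"
  define U where "U = mat ?n s (\<lambda>(i, t). if i < p then (X * ?T) $$ (i, t)
    else if i < p + s then 1\<^sub>m s $$ (i - p, t) else 0)"
  \<comment> \<open>\<open>G\<close> is the stack of \<open>X\<close>, \<open>P\<close> and 0, which
    equals \<open>U * P\<close> because \<open>transpose_mat P * P\<close> is the identity.\<close>
  define G where "G = mat ?n s (\<lambda>(i, t). if i < p then X $$ (i, t)
    else if i < p + s then P $$ (i - p, t) else 0)"
  define V where "V = mat s ?n (\<lambda>(t, j). if j < p then 0
    else if j < p + s then 1\<^sub>m s $$ (t, j - p) else (?T * Y) $$ (t, j - p - s))"
  have T: "?T \<in> carrier_mat s s" using P by simp
  have U: "U \<in> carrier_mat ?n s" and V: "V \<in> carrier_mat s ?n" and G: "G \<in> carrier_mat ?n s"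
    by (simp_all add: U_def V_def G_def)
  have XTP: "X * ?T * P = X" using X T P PTP by (simp add: assoc_mult_mat[OF X T P])
  have XTY: "X * (?T * Y) = X * ?T * Y" using assoc_mult_mat[OF X T Y] by simp
  have PTY: "P * (?T * Y) = Y" using assoc_mult_mat[OF P T Y] PPT Y by simp
  have rowU: "row U i = (if i < p then row (X * ?T) i
      else if i < p + s then row (1\<^sub>m s) (i - p) else 0\<^sub>v s)" if "i < ?n" for i
    using that X P by (intro eq_vecI) (auto simp: U_def)
  have rowG: "row G i = (if i < p then row X i
      else if i < p + s then row P (i - p) else 0\<^sub>v s)" if "i < ?n" for i
    using that X P by (intro eq_vecI) (auto simp: G_def)
  have colV: "col V j = (if j < p then 0\<^sub>v s
      else if j < p + s then col (1\<^sub>m s) (j - p) else col (?T * Y) (j - p - s))" if "j < ?n" for j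
    using that Y P by (intro eq_vecI) (auto simp: V_def)
  have UP: "U * P = G"
  proof (rule eq_matI)
    fix i j assume "i < dim_row G" "j < dim_col G"
    then have ij: "i < ?n" "j < s" using G by auto
    have "(U * P) $$ (i, j) = row U i \<bullet> col P j" using U P ij by simp
    also have "\<dots> = (if i < p then (X * ?T * P) $$ (i, j)
        else if i < p + s then (1\<^sub>m s * P) $$ (i - p, j) else 0)"
    proof -
      have "row (X * ?T) i \<bullet> col P j = (X * ?T * P) $$ (i, j)" if "i < p"
        by (rule index_mult_mat(1)[symmetric]) (use that ij X P in auto)
      moreover have "row (1\<^sub>m s) (i - p) \<bullet> col P j = (1\<^sub>m s * P) $$ (i - p, j)"
        if "\<not> i < p" "i < p + s"
        by (rule index_mult_mat(1)[symmetric]) (use that ij P in auto)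
      moreover have "0\<^sub>v s \<bullet> col P j = 0" using ij P by simp
      ultimately show ?thesis
        unfolding rowU[OF ij(1)] by (simp only: split: if_split) blast
    qed
    also have "\<dots> = G $$ (i, j)"
      using ij P unfolding XTP by (simp add: G_def)
    finally show "(U * P) $$ (i, j) = G $$ (i, j)" .
  qed (use U P G in auto)
  have GV: "G * V = cyclic_block_form X P Y"
  proof (rule eq_matI)
    fix i j assume "i < dim_row (cyclic_block_form X P Y)" "j < dim_col (cyclic_block_form X P Y)"
    then have ij: "i < ?n" "j < ?n" using cyclic_block_form_carrier[OF X P Y] by auto
    \<comment> \<open>This is the last block column; its middle block is \<open>Y\<close> because
      \<open>P * ?T\<close> is the identity.\<close>
    have G_T: "row G i \<bullet> col (?T * Y) l = (if i < p then (X * ?T * Y) $$ (i, l)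
        else if i < p + s then Y $$ (i - p, l) else 0)" if "l < q" for l
    proof -
      have "row G i \<bullet> col (?T * Y) l = (if i < p then (X * (?T * Y)) $$ (i, l)
          else if i < p + s then (P * (?T * Y)) $$ (i - p, l) else 0)"
      proof -
        have "row X i \<bullet> col (?T * Y) l = (X * (?T * Y)) $$ (i, l)" if "i < p"
          by (rule index_mult_mat(1)[symmetric]) (use that \<open>l < q\<close> X Y in auto)
        moreover have "row P (i - p) \<bullet> col (?T * Y) l = (P * (?T * Y)) $$ (i - p, l)"
          if "\<not> i < p" "i < p + s"
          by (rule index_mult_mat(1)[symmetric]) (use that \<open>l < q\<close> P Y in auto)
        moreover have "0\<^sub>v s \<bullet> col (?T * Y) l = 0" using \<open>l < q\<close> P Y by simp
        ultimately show ?thesis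
          unfolding rowG[OF ij(1)] by (simp only: split: if_split) blast
      qed
      then show ?thesis unfolding XTY PTY .
    qed
    have G_1: "row G i \<bullet> col (1\<^sub>m s) l = G $$ (i, l)" if "l < s" for l
    proof -
      have "row G i \<bullet> col (1\<^sub>m s) l = (G * 1\<^sub>m s) $$ (i, l)"
        using ij that G by simp
      then show ?thesis using G by simp
    qed
    have G_0: "row G i \<bullet> 0\<^sub>v s = 0" using G ij by auto
    have "(G * V) $$ (i, j) = row G i \<bullet> col V j" using G V ij by simp
    also have "\<dots> = cyclic_block_form X P Y $$ (i, j)"
      unfolding index_cyclic_block_form[OF X P Y ij] colV[OF ij(2)]
      using ij G_T[of "j - p - s"] G_1[of "j - p"] G_0
      by (auto simp: G_def)
    finally show "(G * V) $$ (i, j) = cyclic_block_form X P Y $$ (i, j)" .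
  qed (use G V cyclic_block_form_carrier[OF X P Y] in auto)
  have VU: "V * U = 1\<^sub>m s"
  proof (rule eq_matI)
    fix t u assume "t < dim_row (1\<^sub>m s)" "u < dim_col (1\<^sub>m s)"
    then have tu: "t < s" "u < s" by auto
    have "(V * U) $$ (t, u) = (\<Sum>l<?n. V $$ (t, l) * U $$ (l, u))"
      using index_mult_mat_sum[OF V U tu] .
    \<comment> \<open>\<open>V\<close> vanishes on the first \<open>p\<close> indices and
      \<open>U\<close> on the last \<open>q\<close>, so only the two identity blocks meet.\<close>
    also have "\<dots> = (\<Sum>l<?n. if l = p + t then (if t = u then 1 else 0) else 0)"
      using tu by (intro sum.cong) (auto simp: V_def U_def)
    also have "\<dots> = 1\<^sub>m s $$ (t, u)" using tu by simp
    finally show "(V * U) $$ (t, u) = 1\<^sub>m s $$ (t, u)" .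
  qed (use U V in auto)
  show ?thesis
    using pow_mat_sandwich[OF U P V VU, of a] unfolding Pa UP GV .
qed

section \<open>From a potent 0/1 matrix to the block form\<close>

lemma zero_one_mat_iff:
  assumes "A \<in> carrier_mat n m"
  shows "zero_one_mat A \<longleftrightarrow> (\<forall>i<n. \<forall>j<m. A $$ (i, j) = 0 \<or> A $$ (i, j) = 1)"
  using assms unfolding zero_one_mat_def by (auto intro: elements_matI dest!: elements_matD)

text \<open>In characteristic 0 the embedding \<open>of_nat\<close> is injective, so the equation
  can be pulled back to the natural numbers, where positivity arguments apply.\<close>

lemma potent_imp_block_form:
  fixes A :: "'a::{comm_ring_1,ring_char_0} mat"
  assumes A: "A \<in> carrier_mat n n" and bin: "zero_one_mat A" and k: "k \<ge> 2"
    and Ak: "A ^\<^sub>m k = A" and nz: "A \<noteq> 0\<^sub>m n n"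
  shows "\<exists>(p::nat) (q::nat) (ns :: nat list) (P :: 'a mat) (X :: 'a mat) (Y :: 'a mat).
       ns \<noteq> [] \<and> (\<forall>m\<in>set ns. 1 \<le> m \<and> m dvd k - 1) \<and>
       P = diag_block_mat (map circulant_mat ns) \<and>
       X \<in> carrier_mat p (sum_list ns) \<and> zero_one_mat X \<and>
       Y \<in> carrier_mat (sum_list ns) q \<and> zero_one_mat Y \<and>
       zero_one_mat (X * transpose_mat P * Y) \<and>
       permutation_similar A (cyclic_block_form X P Y)"
proof -
  interpret of_nat: inj_semiring_hom "of_nat :: nat \<Rightarrow> 'a"
    by unfold_locales auto
  have binA: "A $$ (i, j) = 0 \<or> A $$ (i, j) = 1" if "i < n" "j < n" for i j
    using bin that by (simp add: zero_one_mat_iff[OF A])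
  define N :: "nat mat" where "N = map_mat (\<lambda>x. if x = 0 then 0 else 1) A"
  have N: "N \<in> carrier_mat n n" using A by (simp add: N_def)
  have AN: "A = map_mat of_nat N"
    using A binA by (intro eq_matI) (fastforce simp: N_def)+
  have "map_mat of_nat (N ^\<^sub>m k) = (map_mat of_nat N :: 'a mat)"
    using of_nat.mat_hom_pow[OF N] Ak AN by simp
  then have "N ^\<^sub>m k = N" by (rule of_nat.mat_hom_inj)
  then obtain S f where S: "S \<subseteq> {..<n}" "f ` S \<subseteq> S" "\<And>s. s \<in> S \<Longrightarrow> (f ^^ (k - 1)) s = s"
      and fS: "\<And>s t. s \<in> S \<Longrightarrow> t \<in> S \<Longrightarrow> N $$ (s, t) = (if t = f s then 1 else 0)"
      and NS: "\<And>i j. i < n \<Longrightarrow> j < n \<Longrightarrow> N $$ (i, j) = (\<Sum>t\<in>S. N $$ (i, f t) * N $$ (t, j))"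
      and off: "\<And>l. l < n \<Longrightarrow> l \<notin> S \<Longrightarrow> (\<forall>i<n. N $$ (i, l) = 0) \<or> (\<forall>j<n. N $$ (l, j) = 0)"
    using potent_nat_mat_structure[OF N k] by blast
  have finS: "finite S" using S(1) finite_subset by blast
  have entry: "A $$ (i, j) = of_nat (N $$ (i, j))" if "i < n" "j < n" for i j
    using that N by (simp add: AN)
  have "k - 1 > 0" using k by simp
  from ex_cycle_list[OF finS S(2) this S(3)] obtain cs where
    cs: "distinct (concat cs)" "set (concat cs) = S"
      "\<And>c. c \<in> set cs \<Longrightarrow> c \<noteq> [] \<and> length c dvd k - 1 \<and>
        (\<forall>i<length c. f (c ! i) = c ! ((i + 1) mod length c))"
    by blast
  define ns where "ns = map length cs"
  define xs where "xs = concat cs"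
  define s where "s = length xs"
  have xs: "distinct xs" "set xs = S" using cs by (simp_all add: xs_def)
  have sum_ns: "sum_list ns = s" by (simp add: ns_def s_def xs_def length_concat)
  \<comment> \<open>\<open>T1\<close> takes every index outside \<open>S\<close> with zero column,
    even if its row is zero too; the indices left for \<open>T3\<close> then have zero rows by
    \<open>off\<close>.\<close>
  define T1 where "T1 = {l. l < n \<and> l \<notin> S \<and> (\<forall>i<n. N $$ (i, l) = 0)}"
  define T3 where "T3 = {l. l < n \<and> l \<notin> S \<and> l \<notin> T1}"
  obtain L1 where L1: "distinct L1" "set L1 = T1"
    using finite_distinct_list[of T1] by (auto simp: T1_def)
  obtain L3 where L3: "distinct L3" "set L3 = T3"
    using finite_distinct_list[of T3] by (auto simp: T3_def)
  define p where "p = length L1"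
  define q where "q = length L3"
  define L where "L = L1 @ xs @ L3"
  have L: "distinct L" "set L = {..<n}"
    using L1 L3 xs S(1) by (auto simp: L_def T1_def T3_def)
  have n: "n = p + s + q"
    using distinct_card[OF L(1)] L(2) by (simp add: L_def p_def q_def s_def)
  have L1_nth: "L1 ! i \<in> T1" if "i < p" for i using that L1(2) nth_mem by (auto simp: p_def)
  have xs_nth: "xs ! i \<in> S" if "i < s" for i using that xs(2) nth_mem by (auto simp: s_def)
  have L3_nth: "L3 ! i \<in> T3" if "i < q" for i using that L3(2) nth_mem by (auto simp: q_def)
  have T1_n: "l < n" if "l \<in> T1" for l using that by (simp add: T1_def)
  have T3_n: "l < n" if "l \<in> T3" for l using that by (simp add: T3_def)
  have S_n: "l < n" if "l \<in> S" for l using that S(1) by auto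
  have f_S: "f l \<in> S" if "l \<in> S" for l using that S(2) by auto
  have T1_0: "A $$ (i, l) = 0" if "i < n" "l \<in> T1" for i l
    using that entry[of i l] by (simp add: T1_def)
  have T3_0: "A $$ (l, j) = 0" if "j < n" "l \<in> T3" for j l
    using that entry[of l j] off[of l] by (auto simp: T3_def T1_def)
  define P :: "'a mat" where "P = diag_block_mat (map circulant_mat ns)"
  define X where "X = mat p s (\<lambda>(i, j). A $$ (L1 ! i, xs ! j))"
  define Y where "Y = mat s q (\<lambda>(i, j). A $$ (xs ! i, L3 ! j))"
  have P_eq: "P = mat s s (\<lambda>(i, j). if xs ! j = f (xs ! i) then 1 else 0)"
    unfolding P_def ns_def s_def xs_def by (rule diag_block_circulant_eq) (use cs in auto)
  have X: "X \<in> carrier_mat p s" and P: "P \<in> carrier_mat s s" and Y: "Y \<in> carrier_mat s q"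
    by (simp_all add: X_def P_eq Y_def)
  have P_entry: "P $$ (i, j) = A $$ (xs ! i, xs ! j)" if "i < s" "j < s" for i j
    using that fS[OF xs_nth xs_nth] entry[OF S_n S_n, OF xs_nth xs_nth] by (simp add: P_eq)
  have bij: "bij_betw ((!) xs) {..<s} S"
    using bij_betw_nth[OF xs(1)] xs(2) by (simp add: s_def)
  \<comment> \<open>Multiplying by the transpose of \<open>P\<close> brings the column of
    \<open>f (xs ! t)\<close> to position \<open>t\<close>, which matches the factor
    \<open>N $$ (i, f t)\<close> in \<open>NS\<close>.\<close>
  have XPT: "(X * transpose_mat P) $$ (i, t) = A $$ (L1 ! i, f (xs ! t))" if it: "i < p" "t < s" for i t
  proof -
    have "(X * transpose_mat P) $$ (i, t) = (\<Sum>r<s. X $$ (i, r) * transpose_mat P $$ (r, t))"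
      using it P by (intro index_mult_mat_sum[OF X]) auto
    also have "\<dots> = (\<Sum>r<s. if xs ! r = f (xs ! t) then A $$ (L1 ! i, xs ! r) else 0)"
      using it by (intro sum.cong) (auto simp: X_def P_eq)
    also have "\<dots> = (\<Sum>y\<in>S. if y = f (xs ! t) then A $$ (L1 ! i, y) else 0)"
      by (rule sum.reindex_bij_betw[OF bij])
    also have "\<dots> = A $$ (L1 ! i, f (xs ! t))"
      using finS f_S[OF xs_nth[OF it(2)]] by simp
    finally show ?thesis .
  qed
  have W: "(X * transpose_mat P * Y) $$ (i, j) = A $$ (L1 ! i, L3 ! j)" if ij: "i < p" "j < q" for i j
  proof -
    have Ln: "L1 ! i < n" "L3 ! j < n" using L1_nth L3_nth T1_n T3_n ij by auto
    have "(X * transpose_mat P * Y) $$ (i, j) = (\<Sum>t<s. (X * transpose_mat P) $$ (i, t) * Y $$ (t, j))"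
      using ij X P by (intro index_mult_mat_sum[OF _ Y]) auto
    also have "\<dots> = (\<Sum>t<s. A $$ (L1 ! i, f (xs ! t)) * A $$ (xs ! t, L3 ! j))"
      using ij XPT by (intro sum.cong) (auto simp: Y_def)
    also have "\<dots> = (\<Sum>t\<in>S. A $$ (L1 ! i, f t) * A $$ (t, L3 ! j))"
      by (rule sum.reindex_bij_betw[OF bij])
    also have "\<dots> = (\<Sum>t\<in>S. of_nat (N $$ (L1 ! i, f t) * N $$ (t, L3 ! j)))"
      using Ln S_n f_S entry by (intro sum.cong) auto
    also have "\<dots> = A $$ (L1 ! i, L3 ! j)"
      using NS[OF Ln] entry[OF Ln] by simp
    finally show ?thesis .
  qed
  have "mat n n (\<lambda>(i, j). A $$ (L ! i, L ! j)) = cyclic_block_form X P Y"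
  proof (rule eq_matI)
    fix i j assume "i < dim_row (cyclic_block_form X P Y)" "j < dim_col (cyclic_block_form X P Y)"
    then have ij: "i < p + s + q" "j < p + s + q"
      using cyclic_block_form_carrier[OF X P Y] by auto
    have L_nth: "L ! i = (if i < p then L1 ! i else if i < p + s then xs ! (i - p) else L3 ! (i - p - s))" for i
      by (auto simp: L_def nth_append p_def s_def)
    have L_n: "L ! i < n" "L ! j < n"
      using L ij n distinct_card[OF L(1)] nth_mem by (metis card_lessThan lessThan_iff)+
    have col: "A $$ (L ! i, L ! j) = 0" if "j < p"
      using T1_0[OF L_n(1) L1_nth[OF that]] that by (simp add: L_nth[of j])
    have row: "A $$ (L ! i, L ! j) = 0" if "\<not> i < p + s"
      using T3_0[OF L_n(2) L3_nth[of "i - p - s"]] that ij by (simp add: L_nth[of i])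
    have "A $$ (L ! i, L ! j) = cyclic_block_form X P Y $$ (i, j)"
    proof (cases "j < p \<or> \<not> i < p + s")
      case True
      then show ?thesis
        unfolding index_cyclic_block_form[OF X P Y ij] using col row by auto
    next
      case False
      then show ?thesis
        unfolding index_cyclic_block_form[OF X P Y ij] L_nth[of i] L_nth[of j]
        using ij P_entry[of "i - p" "j - p"] W[of i "j - p - s"] by (auto simp: X_def Y_def)
    qed
    then show "mat n n (\<lambda>(i, j). A $$ (L ! i, L ! j)) $$ (i, j) = cyclic_block_form X P Y $$ (i, j)"
      using ij n by simp
  qed (use cyclic_block_form_carrier[OF X P Y] n in auto)
  then have sim: "permutation_similar A (cyclic_block_form X P Y)"
    using permutation_similar_reindex[OF A L] by simp
  have "ns \<noteq> []"
  proof
    assume "ns = []"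
    \<comment> \<open>Without cycles the sum in \<open>NS\<close> is empty, so every entry of
      \<open>A\<close> is 0.\<close>
    then have "S = {}" using cs(2) by (simp add: ns_def)
    then have "A = 0\<^sub>m n n"
      using A entry NS by (intro eq_matI) auto
    then show False using nz by simp
  qed
  moreover have "\<forall>m\<in>set ns. 1 \<le> m \<and> m dvd k - 1"
    using cs(3) by (auto simp: ns_def Suc_le_eq)
  moreover have "zero_one_mat X"
    using binA T1_n[OF L1_nth] S_n[OF xs_nth] unfolding zero_one_mat_iff[OF X] by (simp add: X_def)
  moreover have "zero_one_mat Y"
    using binA T3_n[OF L3_nth] S_n[OF xs_nth] unfolding zero_one_mat_iff[OF Y] by (simp add: Y_def)
  moreover have "X * transpose_mat P * Y \<in> carrier_mat p q" using X P Y by auto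
  then have "zero_one_mat (X * transpose_mat P * Y)"
    using binA T1_n[OF L1_nth] T3_n[OF L3_nth] W by (simp add: zero_one_mat_iff del: index_mult_mat)
  ultimately show ?thesis
    using sim X Y P_def unfolding sum_ns[symmetric] by blast
qed

theorem theorem2p4:
  fixes A :: "'a::{comm_ring_1,ring_char_0} mat" and n k :: nat
  assumes "k \<ge> 2"
    and "A \<in> carrier_mat n n"
    and "zero_one_mat A"
  shows "A ^\<^sub>m k = A \<longleftrightarrow>
    A = 0\<^sub>m n n \<or>
    (\<exists>(p::nat) (q::nat) (ns :: nat list) (P :: 'a mat) (X :: 'a mat) (Y :: 'a mat).
       ns \<noteq> [] \<and> (\<forall>m\<in>set ns. 1 \<le> m \<and> m dvd k - 1) \<and>
       P = diag_block_mat (map circulant_mat ns) \<and>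
       X \<in> carrier_mat p (sum_list ns) \<and> zero_one_mat X \<and>
       Y \<in> carrier_mat (sum_list ns) q \<and> zero_one_mat Y \<and>
       zero_one_mat (X * transpose_mat P * Y) \<and>
       permutation_similar A (cyclic_block_form X P Y))"
    (is "_ \<longleftrightarrow> _ \<or> ?form")
proof
  assume "A ^\<^sub>m k = A"
  then show "A = 0\<^sub>m n n \<or> ?form"
    using potent_imp_block_form[OF assms(2,3,1)] by blast
next
  obtain a where k: "k = Suc (Suc a)"
    using assms(1) by (metis Suc_le_D numeral_2_eq_2 Suc_le_mono)
  assume "A = 0\<^sub>m n n \<or> ?form"
  then show "A ^\<^sub>m k = A"
  proof
    assume A0: "A = 0\<^sub>m n n"
    have "A ^\<^sub>m Suc a * A = A"
      unfolding A0 by (intro right_mult_zero_mat pow_carrier_mat) simp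
    then show ?thesis by (simp add: k)
  next
    assume ?form
    then obtain p q ns X Y where ns: "\<forall>m\<in>set ns. 1 \<le> m \<and> m dvd k - 1"
        and X: "X \<in> carrier_mat p (sum_list ns)" and Y: "Y \<in> carrier_mat (sum_list ns) q"
        and sim: "permutation_similar A (cyclic_block_form X (diag_block_mat (map circulant_mat ns)) Y)"
      by blast
    let ?P = "diag_block_mat (map circulant_mat ns) :: 'a mat" and ?s = "sum_list ns"
    have dvd: "m dvd Suc a" if "m \<in> set ns" for m using ns that by (simp add: k)
    have P: "?P \<in> carrier_mat ?s ?s" "?P ^\<^sub>m Suc a = 1\<^sub>m ?s" "?P ^\<^sub>m a = transpose_mat ?P"
      by (rule diag_block_circulant, erule dvd)+
    have P1: "?P ^\<^sub>m 1 = ?P" using P(1) by simp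
    have "?P * transpose_mat ?P = 1\<^sub>m ?s"
      \<comment> \<open>The transpose is the \<open>a\<close>-th power, so the product is the power
        \<open>Suc a = k - 1\<close>, the identity.\<close>
      using pow_mat_add[OF P(1), of 1 a] unfolding P1 P(3) plus_1_eq_Suc P(2) by simp
    moreover have "transpose_mat ?P * ?P = 1\<^sub>m ?s"
      using P(2,3) by simp
    moreover have "?P ^\<^sub>m Suc (Suc a) = ?P"
      unfolding pow_mat.simps(2)[of _ "Suc a"] P(2) by (rule left_mult_one_mat[OF P(1)])
    ultimately have "cyclic_block_form X ?P Y ^\<^sub>m k = cyclic_block_form X ?P Y"
      unfolding k by (rule cyclic_block_form_pow[OF X P(1) Y])
    then show ?thesis by (rule permutation_similar_potent[OF sim])
  qed
qed

end
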